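(* Let $N=\{1,\dots,n\}$, $M=\{1,\dots,m\}$, $\mathcal{X}=\{0,1\}^m$, and for each $i\in N$ let $\mathcal{N}_i(W^i,b^i):\{0,1\}^m\to\mathbb{R}_+$ be a fully connected feed-forward ReLU network with $K_i\in\mathbb{N}$, $K_i\ge 1$, affine maps, layer dimensions $d^i_0=m, d^i_1,\dots,d^i_{K_i-1}, d^i_{K_i}=1$, and fixed real parameters $W^{i,k}\in\mathbb{R}^{d^i_{k+1}\times d^i_k}$, $b^{i,k}\in\mathbb{R}^{d^i_{k+1}}$, $0\le k\le K_i-1$. Let $L\in\mathbb{R}_+$ be a constant satisfying the big-M assumption: for every $i\in N$, every input bundle $x\in\{0,1\}^m$, every $k\in\{1,\dots,K_i\}$ and every $1\le j\le d^i_k$, $\left|(W^{i,k-1}o^{i,k-1}+b^{i,k-1})_j\right|\le L$, where $o^{i,k-1}$ is the output of layer $k-1$ of $\mathcal{N}_i$ on input $x$. Then the DNN-based winner determination problem $$\text{(OP1)}\qquad \max_{a\in\mathcal{X}^n}\ \sum_{i\in N}\mathcal{N}_i(W^i,b^i)(a_i)\quad\text{s.t.}\quad \sum_{i\in N}a_{ij}\le 1\ \ \forall j\in M,\qquad a_{ij}\in\{0,1\}\ \ \forall i\in N,\ j\in M,$$ is equivalent to the mixed integer program $$\text{(OP2)}\qquad \max_{a\in\mathcal{X}^n,\ z^{i,k},\,s^{i,k},\,y^{i,k}}\ \sum_{i\in N} z^{i,K_i}$$ subject to, for all $i\in N$ and all $k\in\{1,\dots,K_i\}$, $$z^{i,0}=a_i,\qquad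 z^{i,k}-s^{i,k}=W^{i,k-1}z^{i,k-1}+b^{i,k-1},$$ $$0\le z^{i,k}\le y^{i,k}\cdot L,\qquad 0\le s^{i,k}\le (1-y^{i,k})\cdot L,\qquad y^{i,k}\in\{0,1\}^{d^i_k},$$ and $a_{ij}\in\{0,1\}$ for all $i\in N$, $j\in M$, and $\sum_{i\in N}a_{ij}\le 1$ for all $j\in M$, where $z^{i,k},s^{i,k}\in\mathbb{R}^{d^i_k}$ for $1\le k\le K_i$. Here "equivalent" means that (OP1) and (OP2) have the same optimal value, and an allocation $a\in\mathcal{X}^n$ is an optimal solution of (OP1) if and only if there exist $z^{i,k},s^{i,k},y^{i,k}$ ($i\in N$, $1\le k\le K_i$) such that $a$ together with these variables is an optimal solution of (OP2).
   Context: $n$ is the number of bidders and $m$ the number of items. An allocation is $a=(a_1,\dots,a_n)\in\mathcal{X}^n$, where $a_i=(a_{i1},\dots,a_{im})\in\{0,1\}^m$ is the indicator vector of the bundle given to bidder $i$. ReLU: $\varphi:\mathbb{R}\to\mathbb{R}_+$, $\varphi(s)=\max(0,s)$, applied componentwise to vectors. The network of bidder $i$ on input $x\in\{0,1\}^m$ has layer outputs defined recursively by $o^{i,0}=x$ and $o^{i,k}=\varphi(W^{i,k-1}o^{i,k-1}+b^{i,k-1})\in\mathbb{R}_+^{d^i_k}$ for $1\le k\le K_i$ (so ReLU is also applied at the output layer), and $\mathcal{N}_i(W^i,b^i)(x)=o^{i,K_i}\in\mathbb{R}_+$, i.e. $$\mathcal{N}_i(W^i,b^i)(x)=\varphi\left(W^{i,K_i-1}\varphi\left(\ldots\varphi(W^{i,0}x+b^{i,0})\ldots\right)+b^{i,K_i-1}\right).$$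 Inequalities between vectors are componentwise, and scalars such as $0$ and $1$ in vector constraints denote constant vectors. Since $d^i_{K_i}=1$, $z^{i,K_i}$ is a real number. *)

theory Defs
  imports "Jordan_Normal_Form.Matrix" "HOL-Library.FuncSet"
begin

text \<open>Vectors and matrices are those of Jordan_Normal_Form: their dimensions are values,
  and components are indexed from 0, so item \<open>j \<in> {1..m}\<close> is component \<open>j - 1\<close>.
  Bidders are \<open>{1..n}\<close>.\<close>

definition relu :: "real \<Rightarrow> real" where
  "relu s = max 0 s"

text \<open>\<open>W\<close>, \<open>b\<close>, \<open>d\<close> are indexed by the layer; \<open>K\<close> is the number of affine maps.\<close>

definition relu_network ::
  "nat \<Rightarrow> nat \<Rightarrow> (nat \<Rightarrow> nat) \<Rightarrow> (nat \<Rightarrow> real mat) \<Rightarrow> (nat \<Rightarrow> real vec) \<Rightarrow> bool" where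
  "relu_network m K d W b \<longleftrightarrow>
     1 \<le> K \<and> d 0 = m \<and> d K = 1 \<and>
     (\<forall>k<K. W k \<in> carrier_mat (d (k + 1)) (d k) \<and> b k \<in> carrier_vec (d (k + 1)))"

primrec layer_output ::
  "(nat \<Rightarrow> real mat) \<Rightarrow> (nat \<Rightarrow> real vec) \<Rightarrow> real vec \<Rightarrow> nat \<Rightarrow> real vec" where
  "layer_output W b x 0 = x"
| "layer_output W b x (Suc k) = map_vec relu (W k *\<^sub>v layer_output W b x k + b k)"

text \<open>The output layer has dimension 1; its only component is the value of the network.\<close>

definition network_value ::
  "nat \<Rightarrow> (nat \<Rightarrow> real mat) \<Rightarrow> (nat \<Rightarrow> real vec) \<Rightarrow> real vec \<Rightarrow> real" where
  "network_value K W b x = layer_output W b x K $ 0"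

definition binary_vecs :: "nat \<Rightarrow> real vec set" where
  "binary_vecs m = {x \<in> carrier_vec m. \<forall>j<m. x $ j \<in> {0, 1}}"

definition allocations :: "nat \<Rightarrow> nat \<Rightarrow> (nat \<Rightarrow> real vec) set" where
  "allocations n m = {1..n} \<rightarrow>\<^sub>E binary_vecs m"

definition big_M ::
  "nat \<Rightarrow> nat \<Rightarrow> (nat \<Rightarrow> nat) \<Rightarrow> (nat \<Rightarrow> nat \<Rightarrow> nat) \<Rightarrow>
   (nat \<Rightarrow> nat \<Rightarrow> real mat) \<Rightarrow> (nat \<Rightarrow> nat \<Rightarrow> real vec) \<Rightarrow> real \<Rightarrow> bool" where
  "big_M n m K d W b L \<longleftrightarrow>
     (\<forall>i\<in>{1..n}. \<forall>x\<in>binary_vecs m. \<forall>k\<in>{1..K i}. \<forall>j<d i k.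
        \<bar>(W i (k - 1) *\<^sub>v layer_output (W i) (b i) x (k - 1) + b i (k - 1)) $ j\<bar> \<le> L)"

definition op1_feasible :: "nat \<Rightarrow> nat \<Rightarrow> (nat \<Rightarrow> real vec) \<Rightarrow> bool" where
  "op1_feasible n m a \<longleftrightarrow>
     a \<in> allocations n m \<and> (\<forall>j<m. (\<Sum>i\<in>{1..n}. a i $ j) \<le> 1)"

definition op1_objective ::
  "nat \<Rightarrow> (nat \<Rightarrow> nat) \<Rightarrow> (nat \<Rightarrow> nat \<Rightarrow> real mat) \<Rightarrow> (nat \<Rightarrow> nat \<Rightarrow> real vec) \<Rightarrow>
   (nat \<Rightarrow> real vec) \<Rightarrow> real" where
  "op1_objective n K W b a = (\<Sum>i\<in>{1..n}. network_value (K i) (W i) (b i) (a i))"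

text \<open>A point of the mixed integer program is a tuple \<open>(a, z, s, y)\<close>. Only the values
  \<open>z i k\<close> with \<open>k \<in> {0..K i}\<close> and \<open>s i k\<close>, \<open>y i k\<close> with \<open>k \<in> {1..K i}\<close>, for \<open>i \<in> {1..n}\<close>,
  are variables of the program; all others are unconstrained and do not occur in the objective.\<close>

type_synonym mip_point =
  "(nat \<Rightarrow> real vec) \<times> (nat \<Rightarrow> nat \<Rightarrow> real vec) \<times> (nat \<Rightarrow> nat \<Rightarrow> real vec) \<times>
   (nat \<Rightarrow> nat \<Rightarrow> real vec)"

fun op2_feasible ::
  "nat \<Rightarrow> nat \<Rightarrow> (nat \<Rightarrow> nat) \<Rightarrow> (nat \<Rightarrow> nat \<Rightarrow> nat) \<Rightarrow>
   (nat \<Rightarrow> nat \<Rightarrow> real mat) \<Rightarrow> (nat \<Rightarrow> nat \<Rightarrow> real vec) \<Rightarrow> real \<Rightarrow> mip_point \<Rightarrow> bool" where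
  "op2_feasible n m K d W b L (a, z, s, y) \<longleftrightarrow>
     a \<in> allocations n m \<and> (\<forall>j<m. (\<Sum>i\<in>{1..n}. a i $ j) \<le> 1) \<and>
     (\<forall>i\<in>{1..n}. z i 0 = a i \<and>
       (\<forall>k\<in>{1..K i}.
          z i k \<in> carrier_vec (d i k) \<and> s i k \<in> carrier_vec (d i k) \<and>
          y i k \<in> binary_vecs (d i k) \<and>
          z i k - s i k = W i (k - 1) *\<^sub>v z i (k - 1) + b i (k - 1) \<and>
          (\<forall>j<d i k. 0 \<le> z i k $ j \<and> z i k $ j \<le> y i k $ j * L) \<and>
          (\<forall>j<d i k. 0 \<le> s i k $ j \<and> s i k $ j \<le> (1 - y i k $ j) * L)))"

fun op2_objective :: "nat \<Rightarrow> (nat \<Rightarrow> nat) \<Rightarrow> mip_point \<Rightarrow> real" where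
  "op2_objective n K (a, z, s, y) = (\<Sum>i\<in>{1..n}. z i (K i) $ 0)"

text \<open>A relation rather than a function, so that it also asserts that the maximum is attained.\<close>

definition optimal_value :: "('a \<Rightarrow> real) \<Rightarrow> ('a \<Rightarrow> bool) \<Rightarrow> real \<Rightarrow> bool" where
  "optimal_value f P v \<longleftrightarrow> (\<exists>x. is_arg_max f P x \<and> f x = v)"

end

theory Submission
  imports Defs
begin

text \<open>A binary \<open>y\<close> forces \<open>z = 0\<close> or \<open>s = 0\<close>, so \<open>z - s = p\<close> with \<open>z, s \<ge> 0\<close> has \<open>z = max 0 p\<close>
  as its only solution. By induction on the layers, every feasible point of the mixed integer
  program carries the layer outputs of the networks in \<open>z\<close>, hence the value of the allocation
  in its objective. Conversely, the big-M assumption makes \<open>z = max 0 p\<close>, \<open>s = max 0 (- p)\<close>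
  feasible. So the projection \<open>(a, z, s, y) \<mapsto> a\<close> maps the feasible set of (OP2) onto that of
  (OP1) and preserves the objective. The maximum exists because there are finitely many
  allocations.\<close>

lemma big_M_constraints_imp_relu:
  assumes "z - s = p" "0 \<le> z" "z \<le> y * L" "0 \<le> s" "s \<le> (1 - y) * L" "y \<in> {0, 1}"
  shows "z = relu p"
  using assms by (auto simp: relu_def)

text \<open>The dimension of \<open>W k' *\<^sub>v v + b k'\<close> is that of \<open>b k'\<close>
  for every \<open>v\<close>, so a case distinction on \<open>k\<close> suffices in place of an
  induction.\<close>

lemma layer_output_carrier:
  assumes "relu_network m K d W b" "x \<in> carrier_vec m" "k \<le> K"
  shows "layer_output W b x k \<in> carrier_vec (d k)"
proof (cases k)
  case 0
  then show ?thesis using assms by (simp add: relu_network_def)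
next
  case (Suc k')
  then have "W k' \<in> carrier_mat (d k) (d k')" "b k' \<in> carrier_vec (d k)"
    using assms by (auto simp: relu_network_def)
  then have "W k' *\<^sub>v layer_output W b x k' + b k' \<in> carrier_vec (d k)"
    by (auto intro!: carrier_vecI)
  then show ?thesis using Suc by simp
qed

text \<open>A vector is determined by its dimension and its components, so \<open>vec m\<close>
  covers the set from a finite function space.\<close>

lemma finite_binary_vecs: "finite (binary_vecs m)"
proof (rule finite_subset)
  show "binary_vecs m \<subseteq> vec m ` ({..<m} \<rightarrow>\<^sub>E {0, 1})"
  proof
    fix x assume x: "x \<in> binary_vecs m"
    then have "x = vec m (restrict (($) x) {..<m})"
      by (auto simp: binary_vecs_def)
    moreover have "restrict (($) x) {..<m} \<in> {..<m} \<rightarrow>\<^sub>E {0, 1}"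
      using x by (auto simp: binary_vecs_def)
    ultimately show "x \<in> vec m ` ({..<m} \<rightarrow>\<^sub>E {0, 1})" by (rule image_eqI)
  qed
  show "finite (vec m ` ({..<m} \<rightarrow>\<^sub>E {0, 1 :: real}))"
    by (intro finite_imageI finite_PiE) auto
qed

lemma finite_allocations: "finite (allocations n m)"
  unfolding allocations_def by (intro finite_PiE finite_binary_vecs) auto

text \<open>Leaving every item unsold shows that the maximum is taken over a nonempty set.\<close>

lemma op1_feasible_zero: "op1_feasible n m (\<lambda>i\<in>{1..n}. 0\<^sub>v m)"
  by (auto simp: op1_feasible_def allocations_def binary_vecs_def)

lemma allocation_carrier:
  assumes "a \<in> allocations n m" "i \<in> {1..n}"
  shows "a i \<in> binary_vecs m" "a i \<in> carrier_vec m"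
  using assms by (auto simp: allocations_def binary_vecs_def)

lemma op2_feasible_layer_output:
  assumes net: "relu_network m (K i) (d i) (W i) (b i)"
    and feas: "op2_feasible n m K d W b L (a, z, s, y)"
    and i: "i \<in> {1..n}" and "k \<le> K i"
  shows "z i k = layer_output (W i) (b i) (a i) k"
  using \<open>k \<le> K i\<close>
proof (induction k)
  case 0
  then show ?case using feas i by simp
next
  case (Suc k)
  \<comment> \<open>The pre-activation is formed from \<open>z\<close>; the induction hypothesis
    turns \<open>z i k\<close> into a layer output only at the end.\<close>
  define p where "p = W i k *\<^sub>v z i k + b i k"
  have p: "p \<in> carrier_vec (d i (Suc k))"
    using net Suc.prems by (auto simp: p_def relu_network_def intro!: carrier_vecI)
  \<comment> \<open>Constraints are indexed by the later layer: those at \<open>Suc k\<close>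
    involve the affine map with index \<open>Suc k - 1\<close>, that is, \<open>k\<close>.\<close>
  have Suc_mem: "Suc k \<in> {1..K i}" using Suc.prems by simp
  have zs: "z i (Suc k) \<in> carrier_vec (d i (Suc k))" "s i (Suc k) \<in> carrier_vec (d i (Suc k))"
      "z i (Suc k) - s i (Suc k) = p"
      "y i (Suc k) \<in> binary_vecs (d i (Suc k))"
    and bounds: "\<forall>j<d i (Suc k). 0 \<le> z i (Suc k) $ j \<and> z i (Suc k) $ j \<le> y i (Suc k) $ j * L"
      "\<forall>j<d i (Suc k). 0 \<le> s i (Suc k) $ j \<and> s i (Suc k) $ j \<le> (1 - y i (Suc k) $ j) * L"
    using feas[simplified] i[simplified] Suc_mem[simplified] unfolding p_def by auto
  have "z i (Suc k) = map_vec relu p"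
  proof (rule eq_vecI)
    fix j assume "j < dim_vec (map_vec relu p)"
    then have j: "j < d i (Suc k)" using p by simp
    have "z i (Suc k) $ j - s i (Suc k) $ j = p $ j"
      using zs j by (metis carrier_vecD index_minus_vec(1))
    moreover have "y i (Suc k) $ j \<in> {0, 1}" using zs j by (simp add: binary_vecs_def)
    ultimately have "z i (Suc k) $ j = relu (p $ j)"
      using bounds j by (intro big_M_constraints_imp_relu) auto
    then show "z i (Suc k) $ j = map_vec relu p $ j" using j p by simp
  qed (use zs p in simp)
  then show ?case using Suc by (simp add: p_def)
qed

lemma op2_feasible_projection:
  assumes net: "\<And>i. i \<in> {1..n} \<Longrightarrow> relu_network m (K i) (d i) (W i) (b i)"
    and feas: "op2_feasible n m K d W b L (a, z, s, y)"
  shows "op1_feasible n m a" "op2_objective n K (a, z, s, y) = op1_objective n K W b a"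
proof -
  show "op1_feasible n m a"
    using feas by (simp add: op1_feasible_def)
  have "z i (K i) = layer_output (W i) (b i) (a i) (K i)" if "i \<in> {1..n}" for i
    using op2_feasible_layer_output[OF net[OF that] feas that] by simp
  then show "op2_objective n K (a, z, s, y) = op1_objective n K W b a"
    by (simp add: op1_objective_def network_value_def)
qed

lemma op1_feasible_lift:
  assumes net: "\<And>i. i \<in> {1..n} \<Longrightarrow> relu_network m (K i) (d i) (W i) (b i)"
    and "0 \<le> L" and bM: "big_M n m K d W b L" and feas: "op1_feasible n m a"
  shows "\<exists>z s y. op2_feasible n m K d W b L (a, z, s, y)"
proof -
  \<comment> \<open>With \<open>p\<close> the pre-activation, \<open>z\<close> is its positive part
    for \<open>k \<ge> 1\<close>, \<open>s\<close> its negative part, and \<open>y\<close> indicates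
    which of the two may be nonzero. Where \<open>p\<close> vanishes, either value of
    \<open>y\<close> would do.\<close>
  define z where "z i = layer_output (W i) (b i) (a i)" for i
  define p where "p i k = W i (k - 1) *\<^sub>v z i (k - 1) + b i (k - 1)" for i k
  define s where "s i k = map_vec (\<lambda>t. relu (- t)) (p i k)" for i k
  define y :: "nat \<Rightarrow> nat \<Rightarrow> real vec"
    where "y i k = map_vec (\<lambda>t. of_bool (0 < t)) (p i k)" for i k
  have a: "a \<in> allocations n m" using feas by (simp add: op1_feasible_def)
  have "z i k \<in> carrier_vec (d i k) \<and> s i k \<in> carrier_vec (d i k) \<and>
      y i k \<in> binary_vecs (d i k) \<and> z i k - s i k = p i k \<and>
      (\<forall>j<d i k. 0 \<le> z i k $ j \<and> z i k $ j \<le> y i k $ j * L) \<and>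
      (\<forall>j<d i k. 0 \<le> s i k $ j \<and> s i k $ j \<le> (1 - y i k $ j) * L)"
    if i: "i \<in> {1..n}" and k: "k \<in> {1..K i}" for i k
  proof -
    have z: "z i k = map_vec relu (p i k)"
      using k by (cases k) (auto simp: z_def p_def)
    have "z i k \<in> carrier_vec (d i k)"
      unfolding z_def using layer_output_carrier[OF net[OF i] allocation_carrier(2)[OF a i]] k by simp
    then have p: "p i k \<in> carrier_vec (d i k)" by (simp add: z)
    \<comment> \<open>The big-M assumption applies because \<open>a i\<close> is a binary input. The
      first bound serves \<open>z\<close> where \<open>y\<close> is 1, the second serves
      \<open>s\<close> where \<open>y\<close> is 0.\<close>
    have "p i k $ j \<le> L" "- p i k $ j \<le> L" if "j < d i k" for j
      using bM i k that allocation_carrier(1)[OF a i] by (simp_all add: big_M_def p_def z_def abs_le_iff)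
    then show ?thesis
      using p \<open>0 \<le> L\<close> by (auto simp: z s_def y_def binary_vecs_def relu_def)
  qed
  then have "op2_feasible n m K d W b L (a, z, s, y)"
    using feas by (auto simp: op1_feasible_def z_def p_def)
  then show ?thesis by blast
qed

lemma is_arg_max_exists:
  fixes f :: "'a \<Rightarrow> real"
  assumes "finite {x. P x}" "P x\<^sub>0"
  shows "\<exists>x. is_arg_max f P x"
proof -
  have "Max (f ` {x. P x}) \<in> f ` {x. P x}"
    using assms by (intro Max_in) auto
  then obtain x where "P x" "f x = Max (f ` {x. P x})"
    by auto
  then have "is_arg_max f P x"
    using assms(1) by (auto simp: is_arg_max_def not_less)
  then show ?thesis ..
qed

text \<open>A point \<open>u\<close> can be improved exactly when \<open>h u\<close> can:
  \<open>h\<close> carries a better point down with its value, and surjectivity lifts a better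
  \<open>x\<close> back.\<close>

lemma is_arg_max_projection:
  fixes f :: "'a \<Rightarrow> real" and g :: "'b \<Rightarrow> real"
  assumes "\<And>u. Q u \<Longrightarrow> P (h u) \<and> g u = f (h u)"
    and "\<And>x. P x \<Longrightarrow> \<exists>u. Q u \<and> h u = x"
    and "Q u"
  shows "is_arg_max g Q u \<longleftrightarrow> is_arg_max f P (h u)"
proof -
  have "(\<exists>v. Q v \<and> g u < g v) \<longleftrightarrow> (\<exists>x. P x \<and> f (h u) < f x)"
    using assms by metis
  then show ?thesis
    using assms(1)[OF assms(3)] assms(3) by (simp add: is_arg_max_def)
qed

theorem theorem1:
  fixes n m :: nat
    and K :: "nat \<Rightarrow> nat"
    and d :: "nat \<Rightarrow> nat \<Rightarrow> nat"
    and W :: "nat \<Rightarrow> nat \<Rightarrow> real mat"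
    and b :: "nat \<Rightarrow> nat \<Rightarrow> real vec"
    and L :: real
  assumes "\<And>i. i \<in> {1..n} \<Longrightarrow> relu_network m (K i) (d i) (W i) (b i)"
    and "0 \<le> L"
    and "big_M n m K d W b L"
  shows "(\<exists>v. optimal_value (op1_objective n K W b) (op1_feasible n m) v \<and>
              optimal_value (op2_objective n K) (op2_feasible n m K d W b L) v) \<and>
         (\<forall>a \<in> allocations n m.
            is_arg_max (op1_objective n K W b) (op1_feasible n m) a \<longleftrightarrow>
            (\<exists>z s y. is_arg_max (op2_objective n K) (op2_feasible n m K d W b L) (a, z, s, y)))"
proof -
  let ?f = "op1_objective n K W b" and ?P = "op1_feasible n m"
  let ?g = "op2_objective n K" and ?Q = "op2_feasible n m K d W b L"
  have proj: "?P (fst u) \<and> ?g u = ?f (fst u)" if "?Q u" for u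
  proof (cases u)
    case (fields a z s y)
    then show ?thesis
      using op2_feasible_projection[of n m K d W b L a z s y] assms(1) that
      by (simp del: op2_feasible.simps op2_objective.simps)
  qed
  have lift: "\<exists>z s y. ?Q (a, z, s, y)" if "?P a" for a
    using assms that by (rule op1_feasible_lift)
  then have surj: "\<exists>u. ?Q u \<and> fst u = a" if "?P a" for a
    using that by (metis fst_conv)
  have arg_max: "is_arg_max ?g ?Q u \<longleftrightarrow> is_arg_max ?f ?P (fst u)" if "?Q u" for u
    using proj surj that by (rule is_arg_max_projection)
  \<comment> \<open>Optimality includes feasibility, so an optimal \<open>a\<close> has a feasible
    point above it by \<open>lift\<close>, and \<open>arg_max\<close> makes that point
    optimal.\<close>
  have iff: "is_arg_max ?f ?P a \<longleftrightarrow> (\<exists>z s y. is_arg_max ?g ?Q (a, z, s, y))" for a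
    using lift arg_max by (metis fst_conv is_arg_max_def)
  have "finite {a. ?P a}"
    by (rule finite_subset[OF _ finite_allocations]) (auto simp: op1_feasible_def)
  from is_arg_max_exists[OF this, OF op1_feasible_zero] obtain a where a: "is_arg_max ?f ?P a" ..
  from iff[THEN iffD1, OF this] obtain z s y where u: "is_arg_max ?g ?Q (a, z, s, y)"
    by (elim exE)
  \<comment> \<open>The common optimal value is \<open>?f a\<close>, attained in the one program at
    \<open>a\<close> and in the other at a point above \<open>a\<close>.\<close>
  have "?g (a, z, s, y) = ?f a"
    using proj[of "(a, z, s, y)"] u by (simp only: is_arg_max_def fst_conv)
  then have "optimal_value ?g ?Q (?f a)"
    unfolding optimal_value_def by (intro exI[of _ "(a, z, s, y)"] conjI u)
  moreover have "optimal_value ?f ?P (?f a)"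
    unfolding optimal_value_def by (intro exI[of _ a] conjI a refl)
  ultimately have "\<exists>v. optimal_value ?f ?P v \<and> optimal_value ?g ?Q v"
    by (intro exI[of _ "?f a"] conjI)
  then show ?thesis
    using iff by (rule conjI[OF _ ballI])
qed

end
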